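(* Let $0<p\le 1$, $q=1-p$, and consider the single-player pile game with boundary with set of choices $R=\{1,-1\}$, with generating functions $G_{n,s}(x)$, $0\le s\le n$. For $0\le s\le n$ write $G_{n,s}(x)=\dfrac{P_{n,s}(x)}{Q_n(x)}$, where $Q_n(x)$ is the common denominator (independent of $s$), normalized so that the numerator of $G_{n,0}(x)$ is $P_{n,0}(x)=(px)^n$, and the $P_{n,s}(x)$ are polynomials. Then $Q_n(x)$ satisfies $$Q_n(x)=Q_{n-1}(x)-qp\,x^2\,Q_{n-2}(x)\qquad(n\ge2),$$ with $Q_0(x)=1$ and $Q_1(x)=1-qx$.
   Context: Single-player pile game with boundary, $R=\{1,-1\}$: the player starts with $s$ chips, $0\le s\le n$. In each turn, independently, with probability $p$ one chip is added, and with probability $q=1-p$ one chip is removed, except that if the player has $0$ chips he stays at $0$ instead. The game ends when the player first has $n$ chips (at turn $0$ if $s=n$). $B_n(k,s)$ is the probability that the game ends at the $k$-th turn, and $G_{n,s}(x)=\sum_{k\ge0}B_n(k,s)x^k$. In particular $G_{n,n}(x)=1$ for all $n\ge0$. The functions $G_{n,s}(x)$, $0\le s\le n$, are rational with a common denominator. *)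

theory Defs
  imports
    "HOL-Probability.Probability"
    "HOL-Computational_Algebra.Computational_Algebra"
begin

text \<open>
  The game is realised on the space of infinite sequences of independent coin flips;
  flip \<open>t\<close> comes up \<open>True\<close> (add a chip) with probability \<open>p\<close> and
  \<open>False\<close> (remove a chip, if there is one) with probability \<open>1 - p\<close>.
\<close>

definition coin_flips :: "real \<Rightarrow> bool stream measure" where
  "coin_flips p = stream_space (measure_pmf (bernoulli_pmf p))"

text \<open>
  The walk is continued past the end of the game; this is harmless, since
  \<open>game_ends_at\<close> only looks at the first visit to \<open>n\<close>.
\<close>

primrec chips :: "nat \<Rightarrow> bool stream \<Rightarrow> nat \<Rightarrow> nat" where
  "chips s \<omega> 0 = s"
| "chips s \<omega> (Suc t) =
    (if \<omega> !! t then chips s \<omega> t + 1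
     else if chips s \<omega> t = 0 then 0
     else chips s \<omega> t - 1)"

definition game_ends_at :: "nat \<Rightarrow> nat \<Rightarrow> bool stream \<Rightarrow> nat \<Rightarrow> bool" where
  "game_ends_at n s \<omega> k \<longleftrightarrow> chips s \<omega> k = n \<and> (\<forall>j<k. chips s \<omega> j \<noteq> n)"

definition B :: "real \<Rightarrow> nat \<Rightarrow> nat \<Rightarrow> nat \<Rightarrow> real" where
  "B p n k s = measure (coin_flips p) {\<omega> \<in> space (coin_flips p). game_ends_at n s \<omega> k}"

definition G :: "real \<Rightarrow> nat \<Rightarrow> nat \<Rightarrow> real fps" where
  "G p n s = Abs_fps (\<lambda>k. B p n k s)"

lemma chips_measurable [measurable]:
  "(\<lambda>\<omega>. chips s \<omega> t) \<in> measurable (coin_flips p) (count_space UNIV)"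
  unfolding coin_flips_def by (induction t) simp_all

lemma game_ends_at_measurable [measurable]:
  "Measurable.pred (coin_flips p) (\<lambda>\<omega>. game_ends_at n s \<omega> k)"
  unfolding game_ends_at_def by measurable

text \<open>
  The equations \<open>G\<^bsub>n,s\<^esub> = P\<^bsub>n,s\<^esub> / Q\<^sub>n\<close> for \<open>s \<le> n\<close>, cleared of denominators, with
  \<open>P\<^bsub>n,0\<^esub> = (p x)\<^sup>n\<close>. The polynomials \<open>P n s\<close> with \<open>s > n\<close> are irrelevant.
\<close>

definition normalized_fractions ::
    "real \<Rightarrow> (nat \<Rightarrow> nat \<Rightarrow> real poly) \<Rightarrow> (nat \<Rightarrow> real poly) \<Rightarrow> bool" where
  "normalized_fractions p P Q \<longleftrightarrow>
    (\<forall>n. Q n \<noteq> 0 \<and>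
         (\<forall>s\<le>n. fps_of_poly (Q n) * G p n s = fps_of_poly (P n s)) \<and>
         P n 0 = [:0, p:] ^ n)"

end

theory Submission imports Defs begin

text \<open>
  Conditioning on the first flip gives \<open>G\<^bsub>n,s\<^esub> = p x G\<^bsub>n,s+1\<^esub> + q x G\<^bsub>n,s-1\<^esub>\<close> for
  \<open>s \<noteq> n\<close>, with \<open>G\<^bsub>n,0\<^esub>\<close> in place of \<open>G\<^bsub>n,-1\<^esub>\<close>. If \<open>Q\<^sub>s\<close> is defined by the claimed
  recurrence, induction on \<open>s \<le> n\<close> therefore yields \<open>Q\<^sub>s G\<^bsub>n,0\<^esub> = (p x)\<^sup>s G\<^bsub>n,s\<^esub>\<close>. For \<open>s = n\<close>
  this is \<open>Q\<^sub>n G\<^bsub>n,0\<^esub> = (p x)\<^sup>n\<close>, which determines \<open>Q\<^sub>n\<close>, and cancelling \<open>(p x)\<^sup>s\<close> gives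
  \<open>Q\<^sub>n G\<^bsub>n,s\<^esub> = (p x)\<^bsup>n-s\<^esup> Q\<^sub>s\<close>.
\<close>

text \<open>Truncated subtraction on \<open>nat\<close> gives \<open>0 - 1 = 0\<close>, so
  \<open>s - 1\<close> also covers the player who stays at 0 chips.\<close>

lemma chips_SCons:
  "chips s (a ## \<omega>) (Suc t) = chips (if a then s + 1 else s - 1) \<omega> t"
  by (induction t) auto

lemma game_ends_at_SCons:
  assumes "s \<noteq> n"
  shows "game_ends_at n s (a ## \<omega>) (Suc k) \<longleftrightarrow>
    game_ends_at n (if a then s + 1 else s - 1) \<omega> k"
  using assms by (simp only: game_ends_at_def chips_SCons All_less_Suc2 chips.simps(1)) simp

lemma prob_space_coin_flips: "prob_space (coin_flips p)"
  unfolding coin_flips_def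
  by (intro prob_space.prob_space_stream_space measure_pmf.prob_space_axioms)

lemma space_coin_flips [simp]: "space (coin_flips p) = UNIV"
  by (simp add: coin_flips_def space_stream_space)

lemma B_0: "B p n 0 s = of_bool (s = n)"
  using prob_space.prob_space[OF prob_space_coin_flips, of p]
  by (simp add: B_def game_ends_at_def)

lemma B_Suc_same: "B p n (Suc k) n = 0"
  by (simp add: B_def game_ends_at_def All_less_Suc2)

lemma B_Suc:
  assumes "s \<noteq> n" "0 \<le> p" "p \<le> 1"
  shows "B p n (Suc k) s = p * B p n k (s + 1) + (1 - p) * B p n k (s - 1)"
proof -
  let ?M = "measure_pmf (bernoulli_pmf p)"
  interpret S: prob_space "coin_flips p"
    by (rule prob_space_coin_flips)
  have B_nonneg: "0 \<le> B p n i r" for i r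
    by (simp add: B_def)
  have B_emeasure: "emeasure (coin_flips p) {\<omega>. game_ends_at n r \<omega> i} = ennreal (B p n i r)" for r i
    by (simp add: B_def S.emeasure_eq_measure)
  have sets: "{\<omega>. game_ends_at n s \<omega> (Suc k)} \<in> sets (stream_space ?M)"
    using game_ends_at_measurable[where p = p and n = n and s = s and k = "Suc k"]
    by (simp add: pred_def coin_flips_def space_stream_space)
  have "ennreal (B p n (Suc k) s) = emeasure (stream_space ?M) {\<omega>. game_ends_at n s \<omega> (Suc k)}"
    by (simp add: B_emeasure flip: coin_flips_def)
  \<comment> \<open>The stream measure splits into the first flip and an independent tail with the
    same law; this is the conditioning on the first flip.\<close>
  also have "\<dots> = (\<integral>\<^sup>+a. emeasure (coin_flips p) {\<omega>. game_ends_at n s (a ## \<omega>) (Suc k)} \<partial>?M)"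
    by (subst prob_space.emeasure_stream_space[OF measure_pmf.prob_space_axioms sets])
      (simp add: coin_flips_def space_stream_space)
  also have "\<dots> = (\<integral>\<^sup>+a. ennreal (B p n k (if a then s + 1 else s - 1)) \<partial>?M)"
    by (simp only: game_ends_at_SCons[OF assms(1)] B_emeasure)
  also have "\<dots> = ennreal (p * B p n k (s + 1) + (1 - p) * B p n k (s - 1))"
    using assms B_nonneg
    by (simp add: ennreal_mult'' mult.commute)
  finally show ?thesis
    using assms B_nonneg by (subst (asm) ennreal_inj) auto
qed

lemma G_same: "G p n n = 1"
proof (rule fps_ext)
  show "fps_nth (G p n n) k = fps_nth 1 k" for k
    by (cases k) (simp_all add: G_def B_0 B_Suc_same)
qed

text \<open>Compare coefficients: the constant ones vanish because \<open>s \<noteq> n\<close>, the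
  others are \<open>B_Suc\<close>.\<close>

lemma G_step:
  assumes "s \<noteq> n" "0 \<le> p" "p \<le> 1"
  shows "G p n s = fps_const p * fps_X * G p n (s + 1) + fps_const (1 - p) * fps_X * G p n (s - 1)"
proof (rule fps_ext)
  show "fps_nth (G p n s) k =
    fps_nth (fps_const p * fps_X * G p n (s + 1) + fps_const (1 - p) * fps_X * G p n (s - 1)) k" for k
    using assms by (cases k) (simp_all add: G_def B_0 B_Suc mult.assoc)
qed

fun denom :: "real \<Rightarrow> nat \<Rightarrow> real poly" where
  "denom p 0 = 1"
| "denom p (Suc 0) = [:1, - (1 - p):]"
| "denom p (Suc (Suc n)) = denom p (Suc n) - [:0, 0, (1 - p) * p:] * denom p n"

lemma denom_nonzero: "denom p n \<noteq> 0"
proof -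
  have "coeff (denom p n) 0 = 1"
    by (induction p n rule: denom.induct) simp_all
  then show ?thesis
    by auto
qed

lemma denom_times_G_0:
  assumes "0 \<le> p" "p \<le> 1" "s \<le> n"
  shows "fps_of_poly (denom p s) * G p n 0 = (fps_const p * fps_X) ^ s * G p n s"
  using assms
proof (induction p s rule: denom.induct)
  case (1 p)
  then show ?case
    by simp
next
  case (2 p)
  \<comment> \<open>At the boundary \<open>G p n 0\<close> occurs on both sides of
    \<open>G_step\<close>; collecting it produces the factor 1 - qx.\<close>
  then show ?case
    using G_step[of 0 n p] by (simp add: fps_of_poly_pCons algebra_simps flip: fps_const_neg fps_const_sub)
next
  case (3 p s)
  let ?x = "fps_X :: real fps" and ?p = "fps_const p" and ?q = "fps_const (1 - p)"
  have step: "G p n (Suc s) = ?p * ?x * G p n (Suc (Suc s)) + ?q * ?x * G p n s"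
    using G_step[of "Suc s" n p] 3 by simp
  have "fps_of_poly (denom p (Suc (Suc s))) * G p n 0 =
      fps_of_poly (denom p (Suc s)) * G p n 0 - ?q * ?p * ?x\<^sup>2 * (fps_of_poly (denom p s) * G p n 0)"
    by (simp add: fps_of_poly_diff fps_of_poly_mult fps_of_poly_pCons algebra_simps power2_eq_square
        del: fps_const_sub)
  also have "\<dots> = (?p * ?x) ^ Suc s * G p n (Suc s) - ?q * ?p * ?x\<^sup>2 * ((?p * ?x) ^ s * G p n s)"
    using 3 by simp
  \<comment> \<open>Expanding \<open>G p n (Suc s)\<close> by \<open>step\<close> yields a term in
    \<open>G p n s\<close> that cancels the subtracted one.\<close>
  also have "\<dots> = (?p * ?x) ^ Suc (Suc s) * G p n (Suc (Suc s))"
    unfolding step by (simp add: algebra_simps power2_eq_square del: fps_const_sub fps_const_mult)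
  finally show ?case .
qed

lemma fps_of_poly_linear_power: "fps_of_poly ([:0, p:] ^ n) = (fps_const p * fps_X) ^ n"
  by (simp add: fps_of_poly_power fps_of_poly_pCons)

lemma fps_const_times_X_power_nonzero:
  fixes p :: real
  assumes "p \<noteq> 0"
  shows "(fps_const p * fps_X) ^ n \<noteq> 0"
  using assms by simp

lemma normalized_fractions_denom:
  assumes "0 < p" "p \<le> 1"
  shows "normalized_fractions p (\<lambda>n s. [:0, p:] ^ (n - s) * denom p s) (denom p)"
  unfolding normalized_fractions_def
proof (intro allI conjI impI)
  fix n s :: nat
  assume "s \<le> n"
  let ?y = "fps_const p * fps_X"
  \<comment> \<open>The extra factor \<open>?y ^ s\<close> lets \<open>denom_times_G_0\<close> be
    used at both \<open>s\<close> and \<open>n\<close>; it is cancelled at the end, as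
    \<open>p > 0\<close> makes it nonzero.\<close>
  have "?y ^ s * (fps_of_poly (denom p n) * G p n s)
      = fps_of_poly (denom p n) * (fps_of_poly (denom p s) * G p n 0)"
    using denom_times_G_0[of p s n] assms \<open>s \<le> n\<close> by (simp add: mult_ac)
  also have "\<dots> = fps_of_poly (denom p s) * ?y ^ n"
    using denom_times_G_0[of p n n] assms by (simp add: G_same mult_ac)
  also have "\<dots> = ?y ^ s * (?y ^ (n - s) * fps_of_poly (denom p s))"
    using \<open>s \<le> n\<close> by (simp add: mult_ac flip: power_add mult.assoc)
  finally show "fps_of_poly (denom p n) * G p n s = fps_of_poly ([:0, p:] ^ (n - s) * denom p s)"
    using fps_const_times_X_power_nonzero[of p s] assms(1)
    unfolding fps_of_poly_mult fps_of_poly_linear_power by (metis mult_left_cancel less_irrefl)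
qed (simp_all add: denom_nonzero)

text \<open>The case \<open>s = 0\<close> suffices: \<open>Q n\<close> and \<open>denom p n\<close>
  have the same nonzero product with \<open>G p n 0\<close>, so \<open>G p n 0\<close> is nonzero
  and cancels.\<close>

lemma normalized_fractions_imp_denom:
  assumes "0 < p" "p \<le> 1" "normalized_fractions p P Q"
  shows "Q = denom p"
proof
  fix n
  have "fps_of_poly (Q n) * G p n 0 = (fps_const p * fps_X) ^ n"
    using assms(3) by (simp add: normalized_fractions_def flip: fps_of_poly_linear_power)
  moreover have "fps_of_poly (denom p n) * G p n 0 = (fps_const p * fps_X) ^ n"
    using denom_times_G_0[of p n n] assms by (simp add: G_same)
  ultimately have "fps_of_poly (Q n) = fps_of_poly (denom p n)"
    using fps_const_times_X_power_nonzero[of p n] assms(1)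
    by (metis mult_right_cancel mult_zero_right less_irrefl)
  then show "Q n = denom p n"
    by simp
qed

theorem corollary3:
  fixes p q :: real
  assumes "0 < p" and "p \<le> 1" and "q = 1 - p"
  shows "(\<exists>P Q. normalized_fractions p P Q) \<and>
    (\<forall>P Q. normalized_fractions p P Q \<longrightarrow>
       Q 0 = 1 \<and>
       Q 1 = [:1, - q:] \<and>
       (\<forall>n\<ge>2. Q n = Q (n - 1) - [:0, 0, q * p:] * Q (n - 2)))"
proof (intro conjI allI impI)
  show "\<exists>P Q. normalized_fractions p P Q"
    using normalized_fractions_denom[OF assms(1,2)] by blast
next
  fix P Q
  assume "normalized_fractions p P Q"
  then have Q: "Q = denom p"
    using normalized_fractions_imp_denom assms(1,2) by blast
  show "Q 0 = 1" "Q 1 = [:1, - q:]"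
    by (simp_all add: Q assms(3))
  fix n :: nat
  assume "n \<ge> 2"
  then obtain m where "n = Suc (Suc m)"
    by (metis add_2_eq_Suc le_Suc_ex)
  then show "Q n = Q (n - 1) - [:0, 0, q * p:] * Q (n - 2)"
    by (simp add: Q assms(3))
qed

end
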